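(* Let $X$ and $Y$ be finite polyhedra and let $f:X\to D_n(Y)$ be an $n$-valued map. Then $f$ has a proper partition if and only if there are positive integers $m$ and $l$ with $m+l=n$ such that $f$ lifts to a map $\hat f:X\to D_{m,l}(Y)$, i.e. there is a continuous $\hat f:X\to D_{m,l}(Y)$ with $t_{m,l}\circ \hat f = f$.
   Context: For a topological space $Y$ and a positive integer $n$, $F_n(Y)=\{(y_1,\dots,y_n)\in Y^n \mid y_i\neq y_j \text{ for } i\neq j\}$ has the subspace topology from $Y^n$, and $D_n(Y)=F_n(Y)/\Sigma_n$ (unordered $n$-element subsets of $Y$) has the quotient topology, where $\Sigma_n$ is the symmetric group. An $n$-valued map from $X$ to $Y$ is a continuous function $f:X\to D_n(Y)$; $f(x)$ is regarded as an $n$-element subset of $Y$. A partition of an $n$-valued map $f$ is a set $\{f_1,\dots,f_s\}$ where $f_i:X\to D_{k_i}(Y)$ is a $k_i$-valued (continuous) map, the $k_i$ are positive integers with $k_1+\dots+k_s=n$, and $f(x)=f_1(x)\cup\dots\cup f_s(x)$ for every $x\in X$. The partition is proper if it consists of more than one map ($s\ge 2$). For positive integers $m,l$ with $m+l=n$, the mixed configuration space is the quotient space $D_{m,l}(Y)=F_n(Y)/(\Sigma_m\times\Sigma_l)$, i.e. $D_{m,l}(Y)=\{(\{y_1,\dots,y_m\},\{y_{m+1},\dots,y_n\}) \mid y_i\neq y_j \text{ for } i\neq j\}$. The map $t_{m,l}:D_{m,l}(Y)\to D_n(Y)$ is the covering map $t_{m,l}(\{y_1,\dots,y_m\},\{y_{m+1},\dots,y_n\})=\{y_1,\dots,y_n\}$.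 A finite polyhedron is a space homeomorphic to a finite simplicial complex. *)

theory Defs
  imports "HOL-Analysis.Analysis"
begin

text \<open>
  The library's \<^const>\<open>simplicial_complex\<close> is a finite geometric complex in a Euclidean space. HOL
  cannot quantify existentially over that space, so its type \<open>'e\<close> is a parameter. A hypothesis
  \<open>finite_polyhedron TYPE('e) X\<close> with \<open>'e\<close> a free type variable then covers complexes in Euclidean
  spaces of every dimension.
\<close>

definition finite_polyhedron :: "'e::euclidean_space itself \<Rightarrow> 'a topology \<Rightarrow> bool"
  where "finite_polyhedron _ X \<longleftrightarrow>
    (\<exists>\<K>::'e set set. simplicial_complex \<K> \<and> X homeomorphic_space top_of_set (\<Union>\<K>))"

definition quotient_topology :: "'a topology \<Rightarrow> ('a \<Rightarrow> 'b) \<Rightarrow> 'b topology"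
  where "quotient_topology X q =
    topology (\<lambda>U. U \<subseteq> q ` topspace X \<and> openin X {x \<in> topspace X. q x \<in> U})"

lemma openin_quotient_topology:
  "openin (quotient_topology X q) U \<longleftrightarrow>
    U \<subseteq> q ` topspace X \<and> openin X {x \<in> topspace X. q x \<in> U}"
proof -
  let ?P = "\<lambda>U. U \<subseteq> q ` topspace X \<and> openin X {x \<in> topspace X. q x \<in> U}"
  have "istopology ?P"
    unfolding istopology_def
  proof (intro conjI allI impI)
    fix S T assume S: "?P S" and T: "?P T"
    show "S \<inter> T \<subseteq> q ` topspace X" using S by blast
    have "{x \<in> topspace X. q x \<in> S \<inter> T} =
        {x \<in> topspace X. q x \<in> S} \<inter> {x \<in> topspace X. q x \<in> T}" by blast
    then show "openin X {x \<in> topspace X. q x \<in> S \<inter> T}" using S T by auto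
  next
    fix \<K> assume K: "\<forall>K\<in>\<K>. ?P K"
    show "\<Union>\<K> \<subseteq> q ` topspace X" using K by blast
    have "{x \<in> topspace X. q x \<in> \<Union>\<K>} = (\<Union>K\<in>\<K>. {x \<in> topspace X. q x \<in> K})" by blast
    then show "openin X {x \<in> topspace X. q x \<in> \<Union>\<K>}" using K by auto
  qed
  then show ?thesis
    unfolding quotient_topology_def by (simp add: topology_inverse')
qed

lemma topspace_quotient_topology: "topspace (quotient_topology X q) = q ` topspace X"
proof
  show "topspace (quotient_topology X q) \<subseteq> q ` topspace X"
    by (metis openin_quotient_topology openin_topspace)
  have "{x \<in> topspace X. q x \<in> q ` topspace X} = topspace X" by blast
  then have "openin (quotient_topology X q) (q ` topspace X)"
    by (simp add: openin_quotient_topology)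
  then show "q ` topspace X \<subseteq> topspace (quotient_topology X q)"
    by (rule openin_subset)
qed

lemma quotient_map_quotient_topology: "quotient_map X (quotient_topology X q) q"
  by (auto simp: quotient_map_def topspace_quotient_topology openin_quotient_topology)


definition ordered_config :: "nat \<Rightarrow> 'b topology \<Rightarrow> (nat \<Rightarrow> 'b) topology"
  where "ordered_config n Y =
    subtopology (product_topology (\<lambda>_. Y) {1..n}) {y. inj_on y {1..n}}"

text \<open>
  The orbit of a tuple \<open>y\<close> is represented by the set \<open>y ` {1..n}\<close>, and in the mixed case by the pair
  of the sets of the first \<open>m\<close> and the last \<open>l\<close> entries. The fibres of these maps are exactly the
  orbits of the permutation actions (lemmas \<open>unordered_config_orbit\<close> and \<open>mixed_config_orbit\<close>).
\<close>

definition unordered_config :: "nat \<Rightarrow> 'b topology \<Rightarrow> 'b set topology"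
  where "unordered_config n Y = quotient_topology (ordered_config n Y) (\<lambda>y. y ` {1..n})"

definition mixed_config :: "nat \<Rightarrow> nat \<Rightarrow> 'b topology \<Rightarrow> ('b set \<times> 'b set) topology"
  where "mixed_config m l Y =
    quotient_topology (ordered_config (m + l) Y) (\<lambda>y. (y ` {1..m}, y ` {m+1..m+l}))"

definition mixed_cover :: "'b set \<times> 'b set \<Rightarrow> 'b set"
  where "mixed_cover p = fst p \<union> snd p"

definition valued_map :: "nat \<Rightarrow> 'a topology \<Rightarrow> 'b topology \<Rightarrow> ('a \<Rightarrow> 'b set) \<Rightarrow> bool"
  where "valued_map n X Y f \<longleftrightarrow> 0 < n \<and> continuous_map X (unordered_config n Y) f"

text \<open>
  A partition is given as an indexed family. On a nonempty \<open>X\<close> its members are automatically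
  distinct, so this is the same as a set of \<open>s\<close> maps.
\<close>

definition valued_partition ::
    "'a topology \<Rightarrow> 'b topology \<Rightarrow> nat \<Rightarrow> ('a \<Rightarrow> 'b set) \<Rightarrow> nat \<Rightarrow> (nat \<Rightarrow> nat) \<Rightarrow> (nat \<Rightarrow> 'a \<Rightarrow> 'b set) \<Rightarrow> bool"
  where "valued_partition X Y n f s k g \<longleftrightarrow>
    (\<forall>i\<in>{1..s}. valued_map (k i) X Y (g i)) \<and>
    (\<Sum>i = 1..s. k i) = n \<and>
    (\<forall>x\<in>topspace X. f x = (\<Union>i\<in>{1..s}. g i x))"

definition has_proper_partition :: "'a topology \<Rightarrow> 'b topology \<Rightarrow> nat \<Rightarrow> ('a \<Rightarrow> 'b set) \<Rightarrow> bool"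
  where "has_proper_partition X Y n f \<longleftrightarrow> (\<exists>s\<ge>2. \<exists>k g. valued_partition X Y n f s k g)"


lemma topspace_ordered_config:
  "topspace (ordered_config n Y) = {y \<in> {1..n} \<rightarrow>\<^sub>E topspace Y. inj_on y {1..n}}"
  by (auto simp: ordered_config_def)

lemma config_orbit:
  fixes A :: "'i set"
  assumes y: "inj_on y A" and z: "inj_on z A" and B: "B \<subseteq> A"
    and yz: "y ` B = z ` B" "y ` (A - B) = z ` (A - B)"
  shows "\<exists>p. p permutes A \<and> p ` B = B \<and> (\<forall>i\<in>A. z i = y (p i))"
proof -
  have A: "A = B \<union> (A - B)" using B by blast
  have im: "y ` A = z ` A" using yz B by (metis A image_Un)
  define p where "p i = (if i \<in> A then inv_into A y (z i) else i)" for i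
  have yp: "y (p i) = z i" and pA: "p i \<in> A" if "i \<in> A" for i
  proof -
    have "z i \<in> y ` A" using that im by blast
    then show "y (p i) = z i" "p i \<in> A"
      using that by (auto simp: p_def f_inv_into_f inv_into_into)
  qed
  have inj: "inj_on p A"
    by (rule inj_onI) (metis yp z inj_onD)
  have sub: "p ` C = C" if C: "C \<subseteq> A" "y ` C = z ` C" for C
  proof
    show "p ` C \<subseteq> C"
    proof
      fix j assume "j \<in> p ` C"
      then obtain i where i: "i \<in> C" "j = p i" by blast
      then have "y j \<in> y ` C" using C yp by (metis image_eqI subsetD)
      then show "j \<in> C" using y C(1) pA i by (metis inj_on_image_mem_iff subsetD)
    qed
    show "C \<subseteq> p ` C"
    proof
      fix j assume j: "j \<in> C"
      then obtain i where i: "i \<in> C" "y j = z i" using C(2) by (metis imageE imageI)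
      then have "y (p i) = y j" using yp C(1) by auto
      then have "p i = j" using y pA C(1) i(1) j by (meson inj_onD subsetD)
      then show "j \<in> p ` C" using i by blast
    qed
  qed
  have "p permutes A"
    by (rule bij_imp_permutes)
      (use inj sub[of A] im in \<open>auto simp: bij_betw_def p_def\<close>)
  moreover have "p ` B = B" using sub B yz(1) by blast
  ultimately show ?thesis using yp by metis
qed

lemma unordered_config_orbit:
  assumes "y \<in> topspace (ordered_config n Y)" "z \<in> topspace (ordered_config n Y)"
  shows "y ` {1..n} = z ` {1..n} \<longleftrightarrow>
    (\<exists>p. p permutes {1..n} \<and> (\<forall>i\<in>{1..n}. z i = y (p i)))"
proof
  assume "y ` {1..n} = z ` {1..n}"
  then show "\<exists>p. p permutes {1..n} \<and> (\<forall>i\<in>{1..n}. z i = y (p i))"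
    using config_orbit[of y "{1..n}" z "{1..n}"] assms by (auto simp: topspace_ordered_config)
next
  assume "\<exists>p. p permutes {1..n} \<and> (\<forall>i\<in>{1..n}. z i = y (p i))"
  then obtain p where p: "p permutes {1..n}" "\<forall>i\<in>{1..n}. z i = y (p i)" by blast
  then have "z ` {1..n} = y ` (p ` {1..n})" by (simp add: image_image)
  then show "y ` {1..n} = z ` {1..n}" using permutes_image[OF p(1)] by simp
qed

lemma mixed_config_orbit:
  assumes "y \<in> topspace (ordered_config (m + l) Y)" "z \<in> topspace (ordered_config (m + l) Y)"
  shows "(y ` {1..m}, y ` {m+1..m+l}) = (z ` {1..m}, z ` {m+1..m+l}) \<longleftrightarrow>
    (\<exists>p. p permutes {1..m+l} \<and> p ` {1..m} = {1..m} \<and> (\<forall>i\<in>{1..m+l}. z i = y (p i)))"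
proof -
  have diff: "{1..m+l} - {1..m} = {m+1..m+l}" by auto
  show ?thesis
  proof
    assume "(y ` {1..m}, y ` {m+1..m+l}) = (z ` {1..m}, z ` {m+1..m+l})"
    then show "\<exists>p. p permutes {1..m+l} \<and> p ` {1..m} = {1..m} \<and> (\<forall>i\<in>{1..m+l}. z i = y (p i))"
      using config_orbit[of y "{1..m+l}" z "{1..m}", unfolded diff] assms
      by (auto simp: topspace_ordered_config)
  next
    assume "\<exists>p. p permutes {1..m+l} \<and> p ` {1..m} = {1..m} \<and> (\<forall>i\<in>{1..m+l}. z i = y (p i))"
    then obtain p where p: "p permutes {1..m+l}" "p ` {1..m} = {1..m}"
      "\<forall>i\<in>{1..m+l}. z i = y (p i)" by blast
    have "p ` {m+1..m+l} = p ` {1..m+l} - p ` {1..m}"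
      unfolding diff[symmetric] by (rule image_set_diff[OF permutes_inj[OF p(1)]])
    then have p': "p ` {m+1..m+l} = {m+1..m+l}"
      using permutes_image[OF p(1)] p(2) diff by simp
    have "z ` {1..m} = y ` (p ` {1..m})" "z ` {m+1..m+l} = y ` (p ` {m+1..m+l})"
      using p(3) by (auto simp: image_image intro!: image_cong)
    then show "(y ` {1..m}, y ` {m+1..m+l}) = (z ` {1..m}, z ` {m+1..m+l})"
      using p(2) p' by simp
  qed
qed

lemma topspace_unordered_config:
  "topspace (unordered_config n Y) = {S. S \<subseteq> topspace Y \<and> finite S \<and> card S = n}"
proof (intro set_eqI iffI)
  fix S assume "S \<in> topspace (unordered_config n Y)"
  then show "S \<in> {S. S \<subseteq> topspace Y \<and> finite S \<and> card S = n}"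
    by (auto simp: unordered_config_def topspace_quotient_topology topspace_ordered_config card_image)
next
  fix S assume "S \<in> {S. S \<subseteq> topspace Y \<and> finite S \<and> card S = n}"
  then have S: "S \<subseteq> topspace Y" "finite S" "card S = n" by auto
  obtain h where "bij_betw h {1..card S} S"
    using ex_bij_betw_nat_finite_1[OF S(2)] by blast
  then have h: "bij_betw h {1..n} S"
    unfolding S(3) .
  let ?y = "restrict h {1..n}"
  have im: "?y ` {1..n} = S" and inj: "inj_on ?y {1..n}"
    using bij_betw_imp_surj_on[OF h] bij_betw_imp_inj_on[OF h]
    by (simp_all add: inj_on_restrict_eq)
  have "?y \<in> {1..n} \<rightarrow>\<^sub>E topspace Y"
    using bij_betw_apply[OF h] S(1) by (intro restrict_PiE_iff[THEN iffD2]) blast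
  then have "?y \<in> topspace (ordered_config n Y)"
    using inj by (simp add: topspace_ordered_config)
  then show "S \<in> topspace (unordered_config n Y)"
    unfolding unordered_config_def topspace_quotient_topology using im by (metis image_eqI)
qed

end

theory Submission
  imports Defs
begin

text \<open>
  A continuous map into \<open>D\<^sub>k(Y)\<close> is lower hemicontinuous as a set-valued map, and this property
  passes to unions. Conversely, let \<open>Y\<close> be Hausdorff. A point of \<open>D\<^sub>m\<^sub>,\<^sub>l(Y)\<close> then has neighbourhoods
  given by pairwise disjoint open sets \<open>V\<^sub>1, \<dots>, V\<^sub>m\<^sub>+\<^sub>l\<close>, and a disjoint pair of an \<open>m\<close>-set and an \<open>l\<close>-set
  lies in such a neighbourhood as soon as the former meets \<open>V\<^sub>1, \<dots>, V\<^sub>m\<close> and the latter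
  \<open>V\<^sub>m\<^sub>+\<^sub>1, \<dots>, V\<^sub>m\<^sub>+\<^sub>l\<close>. So the first member of a partition together with the union of the
  others is a continuous lift. In the other direction, the two components of a lift form a partition.
\<close>

section \<open>Separation of finitely many points\<close>

lemma finite_polyhedron_imp_Hausdorff_space:
  assumes "finite_polyhedron TYPE('e::euclidean_space) X"
  shows "Hausdorff_space X"
proof -
  obtain \<K> :: "'e set set" where "X homeomorphic_space top_of_set (\<Union>\<K>)"
    using assms by (auto simp: finite_polyhedron_def)
  then show ?thesis
    using homeomorphic_Hausdorff_space Hausdorff_space_subtopology Hausdorff_space_euclidean by blast
qed

text \<open>Separate each ordered pair of points and intersect, for each point, the finitely many
  neighbourhoods obtained.\<close>

lemma Hausdorff_space_disjoint_family:
  assumes Y: "Hausdorff_space Y" and I: "finite I"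
    and y: "y \<in> I \<rightarrow> topspace Y" "inj_on y I"
  obtains A where "\<And>i. i \<in> I \<Longrightarrow> openin Y (A i)" "\<And>i. i \<in> I \<Longrightarrow> y i \<in> A i"
    "disjoint_family_on A I"
proof -
  \<comment> \<open>The condition on \<open>i\<close> and \<open>j\<close> stands under the
    existential quantifiers so that choice yields total functions \<open>U\<close> and
    \<open>V\<close>.\<close>
  have "\<forall>i j. \<exists>U V. i \<in> I \<and> j \<in> I \<and> i \<noteq> j \<longrightarrow>
      openin Y U \<and> openin Y V \<and> y i \<in> U \<and> y j \<in> V \<and> disjnt U V"
  proof (intro allI)
    fix i j
    show "\<exists>U V. i \<in> I \<and> j \<in> I \<and> i \<noteq> j \<longrightarrow>
        openin Y U \<and> openin Y V \<and> y i \<in> U \<and> y j \<in> V \<and> disjnt U V"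
    proof (cases "i \<in> I \<and> j \<in> I \<and> i \<noteq> j")
      case True
      then have "y i \<in> topspace Y" "y j \<in> topspace Y" "y i \<noteq> y j"
        using y by (auto dest: inj_onD)
      then show ?thesis using Y unfolding Hausdorff_space_def by blast
    next
      case False
      then show ?thesis by (intro exI impI) contradiction
    qed
  qed
  then obtain U V where "\<forall>i j. i \<in> I \<and> j \<in> I \<and> i \<noteq> j \<longrightarrow>
      openin Y (U i j) \<and> openin Y (V i j) \<and> y i \<in> U i j \<and> y j \<in> V i j \<and> disjnt (U i j) (V i j)"
    unfolding choice_iff by blast
  then have UV: "openin Y (U i j)" "openin Y (V i j)" "y i \<in> U i j" "y j \<in> V i j"
      "disjnt (U i j) (V i j)" if "i \<in> I" "j \<in> I" "i \<noteq> j" for i j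
    using that by simp_all
  \<comment> \<open>The choices for \<open>(i, j)\<close> and \<open>(j, i)\<close> are unrelated,
    so \<open>A i\<close> takes the neighbourhoods of \<open>y i\<close> from both. The factor
    \<open>topspace Y\<close> covers a single index, where the intersection over the empty set is
    \<open>UNIV\<close>.\<close>
  define A where "A i = (\<Inter>j\<in>I - {i}. U i j \<inter> V j i) \<inter> topspace Y" for i
  show thesis
  proof
    fix i assume i: "i \<in> I"
    show "openin Y (A i)"
      unfolding A_def using I UV i by (intro openin_INT) auto
    have "y i \<in> U i j \<inter> V j i" if "j \<in> I - {i}" for j
      using UV(3)[of i j] UV(4)[of j i] that i by auto
    then show "y i \<in> A i" using i y(1) by (auto simp: A_def)
  next
    show "disjoint_family_on A I"
      unfolding disjoint_family_on_def
    proof (intro ballI impI)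
      fix i j assume ij: "i \<in> I" "j \<in> I" "i \<noteq> j"
      then have "A i \<subseteq> U i j" "A j \<subseteq> V i j" by (auto simp: A_def)
      then show "A i \<inter> A j = {}" using UV(5)[OF ij] by (auto simp: disjnt_def)
    qed
  qed
qed

section \<open>Points of the mixed configuration space\<close>

text \<open>Enumerations of two disjoint sets concatenate to an injective tuple. Membership can thus
  be checked by counting, without choosing tuples.\<close>

lemma topspace_mixed_config:
  "topspace (mixed_config m l Y) =
    {(S, T). S \<subseteq> topspace Y \<and> T \<subseteq> topspace Y \<and> finite S \<and> finite T \<and>
      card S = m \<and> card T = l \<and> S \<inter> T = {}}" (is "?L = ?R")
proof
  show "?L \<subseteq> ?R"
  proof
    fix p assume "p \<in> ?L"
    then obtain y where y: "y \<in> {1..m+l} \<rightarrow>\<^sub>E topspace Y" "inj_on y {1..m+l}"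
      and p: "p = (y ` {1..m}, y ` {m+1..m+l})"
      by (auto simp: mixed_config_def topspace_quotient_topology topspace_ordered_config)
    have "inj_on y {1..m}" "inj_on y {m+1..m+l}"
      using y(2) by (auto elim: inj_on_subset)
    moreover have "y ` {1..m} \<inter> y ` {m+1..m+l} = {}"
      using inj_on_image_Int[OF y(2), of "{1..m}" "{m+1..m+l}"] by auto
    ultimately show "p \<in> ?R"
      using y(1) by (auto simp: p card_image)
  qed
  show "?R \<subseteq> ?L"
  proof (clarify)
    fix S T assume *: "S \<subseteq> topspace Y" "T \<subseteq> topspace Y" "finite S" "finite T"
      "m = card S" "l = card T" "S \<inter> T = {}"
    obtain g where g: "bij_betw g {1..m} S"
      using finite_same_card_bij[of "{1..m}" S] * by auto
    obtain h where h: "bij_betw h {m+1..m+l} T"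
      using finite_same_card_bij[of "{m+1..m+l}" T] * by auto
    define y where "y = restrict (\<lambda>i. if i \<in> {1..m} then g i else h i) {1..m+l}"
    have yS: "bij_betw y {1..m} S"
      using g by (rule bij_betw_cong[THEN iffD1, rotated]) (auto simp: y_def)
    have yT: "bij_betw y {m+1..m+l} T"
      using h by (rule bij_betw_cong[THEN iffD1, rotated]) (auto simp: y_def)
    have "{1..m} \<union> {m+1..m+l} = {1..m+l}" by auto
    then have y: "bij_betw y {1..m+l} (S \<union> T)"
      using bij_betw_combine[OF yS yT *(7)] by simp
    have "y \<in> {1..m+l} \<rightarrow>\<^sub>E topspace Y"
      using bij_betw_imp_surj_on[OF y] *(1,2) by (auto simp: PiE_iff y_def extensional_def)
    then have "y \<in> topspace (ordered_config (m + l) Y)"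
      using bij_betw_imp_inj_on[OF y] by (simp add: topspace_ordered_config)
    moreover have "(S, T) = (y ` {1..m}, y ` {m+1..m+l})"
      using bij_betw_imp_surj_on[OF yS] bij_betw_imp_surj_on[OF yT] by simp
    ultimately have "(S, T) \<in> topspace (mixed_config m l Y)"
      unfolding mixed_config_def topspace_quotient_topology by blast
    then show "(S, T) \<in> topspace (mixed_config (card S) (card T) Y)"
      using * by simp
  qed
qed

section \<open>Lower hemicontinuity of multivalued maps\<close>

text \<open>A set meets \<open>V\<close> iff some entry of a representing tuple lies in
  \<open>V\<close>, so the preimage in the ordered configuration space is a finite union of
  preimages under coordinate projections.\<close>

lemma openin_unordered_config_meets:
  assumes "openin Y V"
  shows "openin (unordered_config n Y) {S \<in> topspace (unordered_config n Y). S \<inter> V \<noteq> {}}"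
proof -
  let ?F = "ordered_config n Y"
  have "openin ?F {y \<in> topspace ?F. y i \<in> V}" if "i \<in> {1..n}" for i
  proof -
    have "continuous_map ?F Y (\<lambda>y. y i)"
      unfolding ordered_config_def
      using that by (intro continuous_map_from_subtopology continuous_map_product_projection)
    then show ?thesis using assms by (rule openin_continuous_map_preimage)
  qed
  then have "openin ?F (\<Union>i\<in>{1..n}. {y \<in> topspace ?F. y i \<in> V})" by blast
  moreover have "(\<Union>i\<in>{1..n}. {y \<in> topspace ?F. y i \<in> V}) =
      {y \<in> topspace ?F. y ` {1..n} \<in> {S \<in> topspace (unordered_config n Y). S \<inter> V \<noteq> {}}}"
    by (auto simp: unordered_config_def topspace_quotient_topology)
  ultimately show ?thesis
    by (auto simp: unordered_config_def openin_quotient_topology topspace_quotient_topology)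
qed

lemma openin_valued_map_meets:
  assumes "valued_map n X Y f" "openin Y V"
  shows "openin X {x \<in> topspace X. f x \<inter> V \<noteq> {}}"
proof -
  have f: "continuous_map X (unordered_config n Y) f"
    using assms(1) by (simp add: valued_map_def)
  have "{x \<in> topspace X. f x \<inter> V \<noteq> {}} =
      {x \<in> topspace X. f x \<in> {S \<in> topspace (unordered_config n Y). S \<inter> V \<noteq> {}}}"
    using continuous_map_image_subset_topspace[OF f] by auto
  then show ?thesis
    using openin_continuous_map_preimage[OF f openin_unordered_config_meets[OF assms(2)]] by simp
qed

lemma valued_mapD:
  assumes "valued_map n X Y f" "x \<in> topspace X"
  shows "f x \<subseteq> topspace Y" "finite (f x)" "card (f x) = n"
proof -
  have "f x \<in> topspace (unordered_config n Y)"
    using assms continuous_map_image_subset_topspace unfolding valued_map_def by blast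
  then show "f x \<subseteq> topspace Y" "finite (f x)" "card (f x) = n"
    by (auto simp: topspace_unordered_config)
qed

section \<open>Continuity into the mixed configuration space\<close>

text \<open>Lower hemicontinuity suffices because the cardinalities are fixed: \<open>m\<close>
  distinct points found in \<open>a x\<close> and \<open>l\<close> in \<open>b x\<close> exhaust
  these sets.\<close>

lemma continuous_map_mixed_config:
  assumes Y: "Hausdorff_space Y"
    and ab: "\<And>x. x \<in> topspace X \<Longrightarrow> (a x, b x) \<in> topspace (mixed_config m l Y)"
    and a: "\<And>V. openin Y V \<Longrightarrow> openin X {x \<in> topspace X. a x \<inter> V \<noteq> {}}"
    and b: "\<And>V. openin Y V \<Longrightarrow> openin X {x \<in> topspace X. b x \<inter> V \<noteq> {}}"
  shows "continuous_map X (mixed_config m l Y) (\<lambda>x. (a x, b x))"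
  unfolding continuous_map_def
proof (intro conjI allI impI)
  let ?I = "{1..m+l}" and ?q = "\<lambda>y. (y ` {1..m}, y ` {m+1..m+l})"
  show "(\<lambda>x. (a x, b x)) \<in> topspace X \<rightarrow> topspace (mixed_config m l Y)"
    using ab by blast
  fix U assume "openin (mixed_config m l Y) U"
  then have "openin (ordered_config (m + l) Y) {y \<in> topspace (ordered_config (m + l) Y). ?q y \<in> U}"
    by (simp add: mixed_config_def openin_quotient_topology)
  then obtain W where W: "openin (product_topology (\<lambda>_. Y) ?I) W"
    and WU: "{y \<in> topspace (ordered_config (m + l) Y). ?q y \<in> U} = W \<inter> {y. inj_on y ?I}"
    by (auto simp: ordered_config_def openin_subtopology)
  show "openin X {x \<in> topspace X. (a x, b x) \<in> U}"
  proof (subst openin_subopen, intro ballI)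
    fix x0 assume "x0 \<in> {x \<in> topspace X. (a x, b x) \<in> U}"
    then have x0: "x0 \<in> topspace X" and U0: "(a x0, b x0) \<in> U" by auto
    obtain y where y: "y \<in> topspace (ordered_config (m + l) Y)" and qy: "?q y = (a x0, b x0)"
      using ab[OF x0] unfolding mixed_config_def topspace_quotient_topology by force
    have "y \<in> W" using y qy U0 WU by auto
    then obtain B where B: "\<And>i. i \<in> ?I \<Longrightarrow> openin Y (B i)" "y \<in> PiE ?I B" "PiE ?I B \<subseteq> W"
      using W unfolding openin_product_topology_alt by meson
    obtain A where A: "\<And>i. i \<in> ?I \<Longrightarrow> openin Y (A i)" "\<And>i. i \<in> ?I \<Longrightarrow> y i \<in> A i"
      "disjoint_family_on A ?I"
      using Hausdorff_space_disjoint_family[OF Y, of ?I y] y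
      by (auto simp: topspace_ordered_config)
    \<comment> \<open>\<open>B i\<close> will keep a nearby tuple in \<open>W\<close>, and
      \<open>A i\<close> will keep its entries distinct; by \<open>WU\<close> both are required to
      land in \<open>U\<close>.\<close>
    define V where "V i = A i \<inter> B i" for i
    have V: "openin Y (V i)" "y i \<in> V i" if "i \<in> ?I" for i
      using A B that by (auto simp: V_def)
    \<comment> \<open>The factors \<open>topspace X\<close> make the intersections open also for an
      empty index range, that is, for \<open>m = 0\<close> or \<open>l = 0\<close>.\<close>
    define N where "N = ((\<Inter>i\<in>{1..m}. {x \<in> topspace X. a x \<inter> V i \<noteq> {}}) \<inter> topspace X) \<inter>
      ((\<Inter>i\<in>{m+1..m+l}. {x \<in> topspace X. b x \<inter> V i \<noteq> {}}) \<inter> topspace X)"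
    have "openin X N"
      unfolding N_def by (intro openin_Int openin_INT a b V) auto
    moreover have "x0 \<in> N"
    proof -
      have "y i \<in> a x0 \<inter> V i" if "i \<in> {1..m}" for i using that qy V(2)[of i] by auto
      moreover have "y i \<in> b x0 \<inter> V i" if "i \<in> {m+1..m+l}" for i using that qy V(2)[of i] by auto
      ultimately show ?thesis using x0 unfolding N_def by blast
    qed
    moreover have "N \<subseteq> {x \<in> topspace X. (a x, b x) \<in> U}"
    proof
      fix x assume x: "x \<in> N"
      then have xX: "x \<in> topspace X" by (simp add: N_def)
      have "\<exists>z. z \<in> V i \<and> (if i \<in> {1..m} then z \<in> a x else z \<in> b x)" if "i \<in> ?I" for i
      proof (cases "i \<in> {1..m}")
        case True
        then have "a x \<inter> V i \<noteq> {}" using x unfolding N_def by blast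
        then show ?thesis using True by auto
      next
        case False
        then have "i \<in> {m+1..m+l}" using that by auto
        then have "b x \<inter> V i \<noteq> {}" using x unfolding N_def by blast
        then show ?thesis using False by auto
      qed
      \<comment> \<open>One point of \<open>a x\<close> or \<open>b x\<close> is picked in each
        \<open>V i\<close>; these form a tuple representing \<open>(a x, b x)\<close>.\<close>
      then obtain z' where z': "\<And>i. i \<in> ?I \<Longrightarrow>
          z' i \<in> V i \<and> (if i \<in> {1..m} then z' i \<in> a x else z' i \<in> b x)" by metis
      define z where "z = restrict z' ?I"
      have zV: "z i \<in> A i" "z i \<in> B i" if "i \<in> ?I" for i
        using z'[OF that] that by (auto simp: z_def V_def)
      have inj: "inj_on z ?I"
      proof (rule inj_onI, rule ccontr)
        fix i j assume ij: "i \<in> ?I" "j \<in> ?I" "z i = z j" "i \<noteq> j"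
        then have "z i \<in> A i \<inter> A j" using zV(1)[of i] zV(1)[of j] by simp
        then show False using disjoint_family_onD[OF A(3) ij(1,2,4)] by simp
      qed
      have "z \<in> W" using zV(2) B(3) by (auto simp: z_def)
      then have "?q z \<in> U" using inj WU by blast
      moreover have "z ` {1..m} \<subseteq> a x"
        using z' by (force simp: z_def)
      moreover have "z ` {m+1..m+l} \<subseteq> b x"
        using z' by (force simp: z_def)
      moreover have "card (z ` {1..m}) = m" "card (z ` {m+1..m+l}) = l"
        using inj_on_subset[OF inj, of "{1..m}"] inj_on_subset[OF inj, of "{m+1..m+l}"]
        by (auto simp: card_image)
      moreover have "finite (a x)" "finite (b x)" "card (a x) = m" "card (b x) = l"
        using ab[OF xX] by (auto simp: topspace_mixed_config)
      \<comment> \<open>Each inclusion is between finite sets of equal cardinality, hence an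
        equality.\<close>
      ultimately have "?q z = (a x, b x)"
        by (simp add: card_subset_eq)
      with \<open>?q z \<in> U\<close> xX show "x \<in> {x \<in> topspace X. (a x, b x) \<in> U}" by simp
    qed
    ultimately show "\<exists>T. openin X T \<and> x0 \<in> T \<and> T \<subseteq> {x \<in> topspace X. (a x, b x) \<in> U}" by blast
  qed
qed

section \<open>Projections of the mixed configuration space\<close>

text \<open>Selecting the coordinates \<open>h 1, ..., h k\<close> is continuous between ordered
  configuration spaces, since injectivity of \<open>h\<close> keeps the entries distinct; the
  quotient map follows. Both projections arise this way.\<close>

lemma continuous_map_config_reindex:
  assumes h: "inj_on h {1..k}" "h ` {1..k} \<subseteq> {1..n}"
  shows "continuous_map (ordered_config n Y) (unordered_config k Y) (\<lambda>y. y ` h ` {1..k})"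
proof -
  let ?r = "\<lambda>y. \<lambda>i\<in>{1..k}. y (h i)"
  have "continuous_map (ordered_config n Y) (product_topology (\<lambda>_. Y) {1..k}) ?r"
    unfolding continuous_map_componentwise
  proof (intro conjI ballI)
    fix i assume i: "i \<in> {1..k}"
    then have "h i \<in> {1..n}" using h(2) by blast
    then have "continuous_map (ordered_config n Y) Y (\<lambda>y. y (h i))"
      unfolding ordered_config_def
      by (intro continuous_map_from_subtopology continuous_map_product_projection)
    with i show "continuous_map (ordered_config n Y) Y (\<lambda>y. ?r y i)" by simp
  qed auto
  moreover have "inj_on (?r y) {1..k}" if "y \<in> topspace (ordered_config n Y)" for y
    using comp_inj_on[OF h(1) inj_on_subset[OF _ h(2)], of y] that
    by (simp add: topspace_ordered_config inj_on_restrict_eq comp_def)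
  ultimately have "continuous_map (ordered_config n Y) (ordered_config k Y) ?r"
    unfolding ordered_config_def[of k] by (intro continuous_map_into_subtopology) auto
  then have "continuous_map (ordered_config n Y) (unordered_config k Y) ((\<lambda>y. y ` {1..k}) \<circ> ?r)"
    unfolding unordered_config_def
    by (rule continuous_map_compose) (intro quotient_imp_continuous_map quotient_map_quotient_topology)
  then show ?thesis by (simp add: comp_def image_image)
qed

text \<open>By the universal property of the quotient, continuity is tested on ordered tuples, where
  \<open>fst\<close> selects the first \<open>m\<close> coordinates.\<close>

lemma continuous_map_mixed_config_fst:
  "continuous_map (mixed_config m l Y) (unordered_config m Y) fst"
  unfolding mixed_config_def
  using continuous_map_config_reindex[of "\<lambda>i. i" m "m + l" Y]
  by (intro continuous_compose_quotient_map[OF quotient_map_quotient_topology]) (simp add: comp_def)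

lemma continuous_map_mixed_config_snd:
  "continuous_map (mixed_config m l Y) (unordered_config l Y) snd"
proof -
  have im: "(\<lambda>i. i + m) ` {1..l} = {m+1..m+l}"
    by (simp add: image_add_atLeastAtMost' add.commute)
  have "continuous_map (ordered_config (m + l) Y) (unordered_config l Y) (\<lambda>y. y ` {m+1..m+l})"
    using continuous_map_config_reindex[of "\<lambda>i. i + m" l "m + l" Y, unfolded im] by simp
  then show ?thesis
    unfolding mixed_config_def
    by (intro continuous_compose_quotient_map[OF quotient_map_quotient_topology]) (simp add: comp_def)
qed

section \<open>Partitions and lifts\<close>

text \<open>All members after the first are merged into \<open>b\<close>. The points where
  \<open>b\<close> meets an open set form the union of the corresponding open sets for these
  members.\<close>

lemma valued_partition_imp_lift:
  assumes Y: "Hausdorff_space Y" and f: "valued_map n X Y f"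
    and s: "s \<ge> 2" and p: "valued_partition X Y n f s k g"
  defines "b \<equiv> \<lambda>x. \<Union>i\<in>{2..s}. g i x"
  shows "continuous_map X (mixed_config (k 1) (\<Sum>i=2..s. k i) Y) (\<lambda>x. (g 1 x, b x))"
    and "\<And>x. x \<in> topspace X \<Longrightarrow> f x = g 1 x \<union> b x"
    and "k 1 + (\<Sum>i=2..s. k i) = n" and "0 < k 1" and "0 < (\<Sum>i=2..s. k i)"
proof -
  let ?l = "\<Sum>i=2..s. k i"
  have I: "{1..s} = insert 1 {2..s}" using s by auto
  have g: "valued_map (k i) X Y (g i)" if "i \<in> {1..s}" for i
    using p that by (auto simp: valued_partition_def)
  show fab: "f x = g 1 x \<union> b x" if "x \<in> topspace X" for x
  proof -
    have "f x = (\<Union>i\<in>{1..s}. g i x)" using p that by (auto simp only: valued_partition_def)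
    also have "\<dots> = g 1 x \<union> b x" unfolding I b_def by (simp only: UN_insert)
    finally show ?thesis .
  qed
  show n: "k 1 + ?l = n"
    using p I by (simp add: valued_partition_def)
  show "0 < k 1"
    using g[of 1] s by (simp add: valued_map_def)
  have "0 < k 2"
    using g[of 2] s by (simp add: valued_map_def)
  also have "k 2 \<le> ?l"
    using s by (intro member_le_sum) auto
  finally show "0 < ?l" .
  show "continuous_map X (mixed_config (k 1) ?l Y) (\<lambda>x. (g 1 x, b x))"
  proof (rule continuous_map_mixed_config[OF Y])
    fix x assume x: "x \<in> topspace X"
    have gx: "g i x \<subseteq> topspace Y" "finite (g i x)" "card (g i x) = k i" if "i \<in> {1..s}" for i
      using valued_mapD[OF g[OF that] x] by auto
    have fin: "finite (b x)" using gx(2) by (auto simp: b_def)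
    \<comment> \<open>Counting forces disjointness: \<open>card (b x)\<close> is at most
      \<open>?l\<close>, while inclusion-exclusion gives \<open>k 1 + card (b x) = k 1 + ?l\<close>
      plus the size of the overlap, so the overlap is empty and the bound is attained.\<close>
    have "card (b x) \<le> (\<Sum>i=2..s. card (g i x))"
      unfolding b_def by (rule card_UN_le) simp
    also have "\<dots> = ?l" using gx(3) by (intro sum.cong) auto
    finally have "card (b x) \<le> ?l" .
    moreover have "card (g 1 x) + card (b x) = card (f x) + card (g 1 x \<inter> b x)"
      using card_Un_Int[of "g 1 x" "b x"] gx(2)[of 1] fin s fab[OF x] by simp
    moreover have "card (f x) = n" using valued_mapD[OF f x] by simp
    moreover have "card (g 1 x) = k 1" using gx(3)[of 1] s by simp
    ultimately have "card (b x) = ?l" "card (g 1 x \<inter> b x) = 0"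
      using n by linarith+
    moreover have "finite (g 1 x)" "card (g 1 x) = k 1" "g 1 x \<subseteq> topspace Y"
      using gx[of 1] s by auto
    moreover have "b x \<subseteq> topspace Y"
      unfolding b_def using gx(1) by (intro UN_least) simp
    ultimately show "(g 1 x, b x) \<in> topspace (mixed_config (k 1) ?l Y)"
      using fin by (simp add: topspace_mixed_config)
  next
    fix V assume V: "openin Y V"
    show "openin X {x \<in> topspace X. g 1 x \<inter> V \<noteq> {}}"
      using openin_valued_map_meets[OF g V] s by simp
    have "openin X (\<Union>i\<in>{2..s}. {x \<in> topspace X. g i x \<inter> V \<noteq> {}})"
      using openin_valued_map_meets[OF g V] by (intro openin_Union) auto
    moreover have "{x \<in> topspace X. b x \<inter> V \<noteq> {}} =
        (\<Union>i\<in>{2..s}. {x \<in> topspace X. g i x \<inter> V \<noteq> {}})"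
      by (auto simp: b_def)
    ultimately show "openin X {x \<in> topspace X. b x \<inter> V \<noteq> {}}" by simp
  qed
qed

lemma lift_imp_has_proper_partition:
  assumes ml: "0 < m" "0 < l"
    and fh: "continuous_map X (mixed_config m l Y) fh"
    and f: "\<And>x. x \<in> topspace X \<Longrightarrow> mixed_cover (fh x) = f x"
  shows "has_proper_partition X Y (m + l) f"
proof -
  \<comment> \<open>With \<open>s = 2\<close> the \<open>else\<close> branches serve index 2
    alone.\<close>
  define k where "k i = (if i = 1 then m else l)" for i :: nat
  define g where "g i = (if i = 1 then fst \<circ> fh else snd \<circ> fh)" for i :: nat
  have I: "{1..2} = {1, 2::nat}" by auto
  have "valued_partition X Y (m + l) f 2 k g"
    unfolding valued_partition_def I
    using ml f continuous_map_compose[OF fh continuous_map_mixed_config_fst]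
      continuous_map_compose[OF fh continuous_map_mixed_config_snd]
    by (auto simp: k_def g_def valued_map_def mixed_cover_def)
  then show ?thesis
    unfolding has_proper_partition_def by blast
qed

theorem theorem3p2:
  fixes X :: "'a topology" and Y :: "'b topology"
    and n :: nat and f :: "'a \<Rightarrow> 'b set"
  assumes "finite_polyhedron TYPE('e::euclidean_space) X"
    and "finite_polyhedron TYPE('d::euclidean_space) Y"
    and "valued_map n X Y f"
  shows "has_proper_partition X Y n f \<longleftrightarrow>
    (\<exists>m l. 0 < m \<and> 0 < l \<and> m + l = n \<and>
      (\<exists>fh. continuous_map X (mixed_config m l Y) fh \<and>
        (\<forall>x\<in>topspace X. mixed_cover (fh x) = f x)))"
proof
  assume "has_proper_partition X Y n f"
  then obtain s k g where s: "s \<ge> 2" and p: "valued_partition X Y n f s k g"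
    by (auto simp: has_proper_partition_def)
  \<comment> \<open>The polyhedron \<open>Y\<close> enters through its Hausdorff property, inherited
    from Euclidean space.\<close>
  note lift = valued_partition_imp_lift[OF finite_polyhedron_imp_Hausdorff_space[OF assms(2)]
      assms(3) s p]
  let ?fh = "\<lambda>x. (g 1 x, \<Union>i\<in>{2..s}. g i x)"
  have "\<forall>x\<in>topspace X. mixed_cover (?fh x) = f x"
    using lift(2) by (simp add: mixed_cover_def)
  with lift(1,3,4,5) show "\<exists>m l. 0 < m \<and> 0 < l \<and> m + l = n \<and>
      (\<exists>fh. continuous_map X (mixed_config m l Y) fh \<and>
        (\<forall>x\<in>topspace X. mixed_cover (fh x) = f x))"
    by blast
next
  assume "\<exists>m l. 0 < m \<and> 0 < l \<and> m + l = n \<and>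
      (\<exists>fh. continuous_map X (mixed_config m l Y) fh \<and>
        (\<forall>x\<in>topspace X. mixed_cover (fh x) = f x))"
  then show "has_proper_partition X Y n f"
    using lift_imp_has_proper_partition by blast
qed

end
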